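(* There exists an absolute constant $C>0$ with the following property: for every integer $d\geq 2$ there exists a rational function $f$ of degree exactly $d$ such that $$K(f)\leq C\sqrt{d}.$$
   Context: A rational function is a holomorphic map $f:\overline{\mathbf{C}}\to\overline{\mathbf{C}}$ of the Riemann sphere into itself. The Riemann sphere is equipped with the spherical metric with length element $ds=\frac{|dz|}{1+|z|^2}$. The norm of the derivative with respect to the spherical metric is $$\|f'\|(z)=|f'(z)|\,\frac{1+|z|^2}{1+|f(z)|^2},$$ extended by continuity to $z=\infty$ and to the poles of $f$. Define $K(f)=\max_{z\in\overline{\mathbf{C}}}\|f'\|(z)$. *)

theory Defs
  imports "HOL-Complex_Analysis.Complex_Analysis"
    "HOL-Computational_Algebra.Computational_Algebra"
begin

text \<open>The Riemann sphere: \<open>Some z\<close> is the point \<open>z\<close> of the finite plane, \<open>None\<close> is the point at infinity.\<close>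

definition riemann_sphere :: "complex option topology" where
  "riemann_sphere = Alexandroff_compactification (euclidean :: complex topology)"

text \<open>The involution \<open>z \<mapsto> 1/z\<close>. The two charts of the sphere are \<open>the\<close>, with inverse
  \<open>Some\<close>, off infinity, and \<open>the \<circ> sphere_inversion\<close>, with inverse
  \<open>sphere_inversion \<circ> Some\<close>, off zero.\<close>

definition sphere_inversion :: "complex option \<Rightarrow> complex option" where
  "sphere_inversion x =
     (case x of None \<Rightarrow> Some 0 | Some z \<Rightarrow> (if z = 0 then None else Some (1 / z)))"

text \<open>Holomorphic self-maps of the sphere: continuous, and holomorphic when read in any pair of
  charts (\<open>\<alpha>\<close> selects the chart of the source, \<open>\<beta>\<close> that of the target). By
  continuity the sets on which holomorphy is required are open.\<close>

definition rational_function :: "(complex option \<Rightarrow> complex option) \<Rightarrow> bool" where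
  "rational_function f \<longleftrightarrow>
     continuous_map riemann_sphere riemann_sphere f \<and>
     (\<forall>\<alpha>\<in>{id, sphere_inversion}. \<forall>\<beta>\<in>{id, sphere_inversion}.
        (\<lambda>z. the (\<beta> (f (\<alpha> (Some z))))) holomorphic_on
          {z. \<beta> (f (\<alpha> (Some z))) \<noteq> None})"

text \<open>The map \<open>p/q\<close> on the sphere, for coprime \<open>p\<close> and \<open>q\<close>. Its value at infinity is
  read off from the coefficients of degree \<open>n = max (deg p) (deg q)\<close>, i.e. from the homogenized
  pair \<open>[w\<^sup>n p(z/w) : w\<^sup>n q(z/w)]\<close> at \<open>[z : w] = [1 : 0]\<close>.\<close>

definition quotient_map_of :: "complex poly \<Rightarrow> complex poly \<Rightarrow> complex option \<Rightarrow> complex option" where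
  "quotient_map_of p q x =
     (case x of
        Some z \<Rightarrow> (if poly q z = 0 then None else Some (poly p z / poly q z))
      | None \<Rightarrow> (let n = max (degree p) (degree q) in
                 if coeff q n = 0 then None else Some (coeff p n / coeff q n)))"

definition has_degree :: "(complex option \<Rightarrow> complex option) \<Rightarrow> nat \<Rightarrow> bool" where
  "has_degree f d \<longleftrightarrow>
     (\<exists>p q. coprime p q \<and> f = quotient_map_of p q \<and> d = max (degree p) (degree q))"

text \<open>The norm of the derivative in the finite coordinate; meaningful where \<open>z\<close> and \<open>f z\<close> are finite.\<close>

definition spherical_deriv_fin :: "(complex option \<Rightarrow> complex option) \<Rightarrow> complex \<Rightarrow> real" where
  "spherical_deriv_fin f z =
     cmod (deriv (\<lambda>w. the (f (Some w))) z) *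
       ((1 + (cmod z)\<^sup>2) / (1 + (cmod (the (f (Some z))))\<^sup>2))"

text \<open>Its extension by continuity to the poles and to infinity.\<close>

definition spherical_deriv_norm :: "(complex option \<Rightarrow> complex option) \<Rightarrow> complex option \<Rightarrow> real" where
  "spherical_deriv_norm f x =
     (case x of
        Some z \<Rightarrow> (if f (Some z) = None then Lim (at z) (spherical_deriv_fin f)
                   else spherical_deriv_fin f z)
      | None \<Rightarrow> Lim at_infinity (spherical_deriv_fin f))"

definition K :: "(complex option \<Rightarrow> complex option) \<Rightarrow> real" where
  "K f = (GREATEST m. m \<in> range (spherical_deriv_norm f))"

end

theory Submission
  imports Defs
begin

text \<open>
  The degree-\<open>d\<close> monomials, measured in the metric of the line bundle of degree \<open>d\<close> on the sphere,
  peak along parallels, and the peak of \<open>z\<^sup>k\<close> has a width of order \<open>1 / \<surd>d\<close> in spherical distance. Select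
  exponents whose peaks are a sufficiently large fixed multiple of \<open>1 / \<surd>d\<close> apart, scale the
  corresponding monomials so that each one dominates near its own peak, and put them alternately into two polynomials \<open>p\<close> and \<open>q\<close>. At every
  point one monomial dominates and at most its two neighbours are comparable with it; these belong to the
  other polynomial. Hence the polynomial containing the dominant monomial is bounded below by a third of it
  (\<open>sum_of_squares_lower_bound\<close>), so that \<open>p\<close> and \<open>q\<close> have no common zero, and the map \<open>p/q\<close> is a
  rational function of degree \<open>max (deg p) (deg q)\<close>.

  The spherical derivative of \<open>p/q\<close> is \<open>|p' q - p q'| (1 + |z|\<^sup>2) / (|p|\<^sup>2 + |q|\<^sup>2)\<close>. The
  numerator is estimated directly. With \<open>k\<close> the dominant exponent,
  \<open>z (p' q - p q') = (z p' - k p) q - p (z q' - k q)\<close>, and the factors on the right are sums of monomials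
  weighted by the differences of their exponents from \<open>k\<close>. The neighbours of the dominant monomial
  contribute exponent gaps of order \<open>\<surd>d |z| / (1 + |z|\<^sup>2)\<close>, which is the reciprocal of the spacing of
  the peaks in terms of \<open>ln |z|\<close>, and the other monomials decay geometrically (\<open>decay\<close>). So the spherical derivative is
  bounded by a constant times \<open>\<surd>d\<close> (\<open>spherical_speed_le\<close>).

  It remains to realize the spacing with integers that add up to \<open>d\<close>. Exponent gaps proportional to the
  radius, at equally spaced radii in the unit disc and symmetrically outside, have total
  \<open>8 J\<^sup>2\<close> without the central one, and the central gap has enough freedom to reach each \<open>d\<close>
  between consecutive values of \<open>8 J (J + 1)\<close>.

  Since the maximum defining \<open>K\<close> is taken of a function continued to the poles and to infinity, the
  bound for the formula above becomes a bound for \<open>K\<close> only once that function is known to be continuous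
  on the compact sphere (\<open>K_quotient_map_of_le\<close>).
\<close>

section \<open>Coprime quotients as rational functions\<close>

text \<open>
  A common divisor without zeros is constant, by the fundamental theorem of algebra.
\<close>

lemma coprime_if_no_common_root:
  fixes p q :: "complex poly"
  assumes "\<And>z. poly p z \<noteq> 0 \<or> poly q z \<noteq> 0"
  shows "coprime p q"
proof (rule coprimeI)
  fix r assume r: "r dvd p" "r dvd q"
  have no_root: "poly r z \<noteq> 0" for z
    using assms[of z] r by (metis dvd_trans poly_eq_0_iff_dvd)
  then have "degree r = 0"
    using alg_closed_imp_poly_has_root[of r] by blast
  moreover have "r \<noteq> 0"
    using no_root[of 0] by auto
  ultimately show "is_unit r"
    by (simp add: is_unit_iff_degree)
qed

text \<open>
  For \<open>deg p \<le> n\<close> this is \<open>w\<^sup>n p(1/w)\<close>: the section of degree \<open>n\<close> given by \<open>p\<close>, read in the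
  chart at infinity.
\<close>

definition reversed_poly :: "nat \<Rightarrow> complex poly \<Rightarrow> complex poly" where
  "reversed_poly n p = monom 1 (n - degree p) * reflect_poly p"

lemma poly_reversed_poly:
  assumes "degree p \<le> n" "z \<noteq> 0"
  shows "poly (reversed_poly n p) (1 / z) = poly p z / z ^ n"
proof -
  have "poly (reversed_poly n p) (inverse z) = poly p z / z ^ n"
    using assms
    by (simp add: reversed_poly_def poly_monom poly_reflect_poly_nz power_inverse divide_simps
        flip: power_add)
  then show ?thesis by (simp add: inverse_eq_divide)
qed

lemma poly_reversed_poly_0:
  assumes "degree p \<le> n"
  shows "poly (reversed_poly n p) 0 = coeff p n"
proof (cases "degree p = n")
  case True
  then show ?thesis by (auto simp: reversed_poly_def poly_monom)
next
  case False
  with assms show ?thesis by (simp add: reversed_poly_def poly_monom coeff_eq_0)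
qed

lemma poly_over_power_tendsto_coeff:
  fixes p :: "complex poly"
  assumes "degree p \<le> n"
  shows "((\<lambda>z. poly p z / z ^ n) \<longlongrightarrow> coeff p n) at_infinity"
proof -
  have "((\<lambda>z. poly (reversed_poly n p) (1 / z)) \<longlongrightarrow> poly (reversed_poly n p) 0) at_infinity"
    by (intro tendsto_poly tendsto_divide_0[OF tendsto_const filterlim_ident])
  moreover have "\<forall>\<^sub>F z in at_infinity. poly (reversed_poly n p) (1 / z) = poly p z / z ^ n"
    using eventually_not_equal_at_infinity[of 0]
    by eventually_elim (use assms in \<open>simp add: poly_reversed_poly\<close>)
  ultimately show ?thesis
    using assms by (simp add: poly_reversed_poly_0 tendsto_cong)
qed

text \<open>
  No common zero at infinity: one of the two degrees is the maximum, and the leading coefficient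
  belonging to it survives.
\<close>

lemma coeffs_at_max_degree_nonzero:
  fixes p q :: "complex poly"
  assumes "coprime p q"
  shows "coeff p (max (degree p) (degree q)) \<noteq> 0 \<or> coeff q (max (degree p) (degree q)) \<noteq> 0"
proof -
  have "p \<noteq> 0 \<or> q \<noteq> 0"
    using assms by auto
  moreover have "max (degree p) (degree q) = degree p" if "q = 0"
    using that by simp
  moreover have "max (degree p) (degree q) = degree q" if "p = 0"
    using that by simp
  ultimately show ?thesis
    by (metis leading_coeff_0_iff max_def)
qed

text \<open>
  Describes neighbourhoods of infinity by a filter, so that continuity of maps of the sphere becomes
  a statement about limits.
\<close>

lemma openin_riemann_sphere_iff:
  "openin riemann_sphere V \<longleftrightarrow>
     open (Some -` V) \<and> (None \<in> V \<longrightarrow> (\<forall>\<^sub>F z in at_infinity. Some z \<in> V))"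
proof (cases "None \<in> V")
  case False
  have "x \<in> Some ` (Some -` V) \<longleftrightarrow> x \<in> V" for x
    using False by (cases x) auto
  then have "Some ` (Some -` V) = V"
    by blast
  then have "openin riemann_sphere V \<longleftrightarrow> openin riemann_sphere (Some ` (Some -` V))"
    by simp
  also have "\<dots> \<longleftrightarrow> open (Some -` V)"
    unfolding riemann_sphere_def openin_Alexandroff_compactification_image_Some by simp
  finally show ?thesis
    using False by simp
next
  case True
  have "x \<in> V \<longleftrightarrow> x \<in> insert None (Some ` (Some -` V))" for x
    using True by (cases x) auto
  then have "V = insert None (Some ` (Some -` V))"
    by blast
  then have "V = insert None (Some ` (- C)) \<longleftrightarrow> C = - (Some -` V)" for C
    by auto
  moreover have "V \<noteq> Some ` U" for U
    using True by auto
  ultimately have "openin riemann_sphere V \<longleftrightarrow> compact (- (Some -` V)) \<and> closed (- (Some -` V))"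
    by (simp add: riemann_sphere_def openin_Alexandroff_compactification
        Compl_eq_Diff_UNIV[symmetric])
  also have "\<dots> \<longleftrightarrow> open (Some -` V) \<and> bounded (- (Some -` V))"
    unfolding compact_eq_bounded_closed open_closed by blast
  also have "bounded (- (Some -` V)) \<longleftrightarrow> (\<forall>\<^sub>F z in at_infinity. Some z \<in> V)"
  proof
    assume "bounded (- (Some -` V))"
    then obtain b where "\<And>z. z \<in> - (Some -` V) \<Longrightarrow> norm z < b"
      unfolding bounded_pos_less by blast
    then show "\<forall>\<^sub>F z in at_infinity. Some z \<in> V"
      by (intro eventually_at_infinityI[of b]) (force simp: not_less)
  next
    assume "\<forall>\<^sub>F z in at_infinity. Some z \<in> V"
    then obtain b where "\<And>z. b \<le> norm z \<Longrightarrow> Some z \<in> V"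
      unfolding eventually_at_infinity by blast
    then show "bounded (- (Some -` V))"
      by (intro boundedI[of _ b]) (force simp: not_le)
  qed
  finally show ?thesis
    using True by simp
qed

text \<open>
  Continuity of \<open>[P : Q]\<close> in the form that serves at finite points and at infinity alike: if
  \<open>P\<close> and \<open>Q\<close> converge and the limits do not both vanish, the quotient converges on the sphere.
  If the limit of \<open>Q\<close> is zero, the quotient tends to infinity along the points with \<open>Q \<noteq> 0\<close>, and equals
  infinity at the other ones.
\<close>

lemma eventually_quotient_in_open:
  fixes P Q :: "complex \<Rightarrow> complex"
  assumes V: "openin riemann_sphere V"
    and P: "(P \<longlongrightarrow> a) F" and Q: "(Q \<longlongrightarrow> b) F" and ab: "a \<noteq> 0 \<or> b \<noteq> 0"
    and mem: "(if b = 0 then None else Some (a / b)) \<in> V"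
  shows "\<forall>\<^sub>F z in F. (if Q z = 0 then None else Some (P z / Q z)) \<in> V"
proof (cases "b = 0")
  case False
  have "((\<lambda>z. P z / Q z) \<longlongrightarrow> a / b) F"
    by (intro tendsto_divide P Q False)
  moreover have "open (Some -` V)" "a / b \<in> Some -` V"
    using V mem False by (auto simp: openin_riemann_sphere_iff)
  ultimately have "\<forall>\<^sub>F z in F. P z / Q z \<in> Some -` V"
    by (rule topological_tendstoD)
  moreover have "\<forall>\<^sub>F z in F. Q z \<noteq> 0"
    using Q False by (rule tendsto_imp_eventually_ne)
  ultimately show ?thesis
    by eventually_elim auto
next
  case True
  define G where "G = inf F (principal {z. Q z \<noteq> 0})"
  have le: "G \<le> F" by (simp add: G_def)
  have "(P \<longlongrightarrow> a) G" "(Q \<longlongrightarrow> 0) G"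
    using P Q le True by (auto intro: tendsto_mono)
  moreover have "\<forall>\<^sub>F z in G. Q z \<noteq> 0"
    by (simp add: G_def eventually_inf_principal)
  ultimately have lim: "filterlim (\<lambda>z. P z / Q z) at_infinity G"
    using ab True by (intro filterlim_divide_at_infinity[of _ a]) (auto simp: filterlim_at)
  have "None \<in> V" and near: "\<forall>\<^sub>F w in at_infinity. Some w \<in> V"
    using V mem True by (auto simp: openin_riemann_sphere_iff)
  have "\<forall>\<^sub>F z in G. Some (P z / Q z) \<in> V"
    by (rule eventually_compose_filterlim[OF near lim])
  then have "\<forall>\<^sub>F z in F. Q z \<noteq> 0 \<longrightarrow> Some (P z / Q z) \<in> V"
    by (simp add: G_def eventually_inf_principal)
  then show ?thesis
    by eventually_elim (use \<open>None \<in> V\<close> in auto)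
qed

lemma topspace_riemann_sphere [simp]: "topspace riemann_sphere = UNIV"
  unfolding riemann_sphere_def topspace_Alexandroff_compactification topspace_euclidean
  by (rule UNIV_option_conv[symmetric])

lemma continuous_map_quotient_map_of:
  assumes "coprime p q"
  shows "continuous_map riemann_sphere riemann_sphere (quotient_map_of p q)"
  unfolding continuous_map_def
proof (intro conjI allI impI)
  fix V assume V: "openin riemann_sphere V"
  let ?f = "quotient_map_of p q" and ?n = "max (degree p) (degree q)"
  have fin: "\<forall>\<^sub>F z in nhds z0. ?f (Some z) \<in> V" if "?f (Some z0) \<in> V" for z0
  proof -
    have lim: "(poly r \<longlongrightarrow> poly r z0) (nhds z0)" for r :: "complex poly"
      by (rule tendsto_poly[OF filterlim_ident])
    have mem: "(if poly q z0 = 0 then None else Some (poly p z0 / poly q z0)) \<in> V"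
      using that by (simp only: quotient_map_of_def option.case)
    show ?thesis
      using eventually_quotient_in_open[OF V lim lim coprime_poly_0[OF assms] mem]
      by (simp only: quotient_map_of_def option.case)
  qed
  have inf: "\<forall>\<^sub>F z in at_infinity. ?f (Some z) \<in> V" if "?f None \<in> V"
  proof -
    have lim: "((\<lambda>z. poly r z / z ^ ?n) \<longlongrightarrow> coeff r ?n) at_infinity" if "degree r \<le> ?n" for r :: "complex poly"
      using that by (rule poly_over_power_tendsto_coeff)
    have "\<forall>\<^sub>F z in at_infinity.
       (if poly q z / z ^ ?n = 0 then None else Some (poly p z / z ^ ?n / (poly q z / z ^ ?n))) \<in> V"
    proof (rule eventually_quotient_in_open[OF V lim lim coeffs_at_max_degree_nonzero[OF assms]])
      show "(if coeff q ?n = 0 then None else Some (coeff p ?n / coeff q ?n)) \<in> V"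
        using that by (simp only: quotient_map_of_def Let_def option.case)
    qed simp_all
    then show ?thesis
      using eventually_not_equal_at_infinity[of 0]
      by eventually_elim (auto simp: quotient_map_of_def)
  qed
  have "open (Some -` {x. ?f x \<in> V})"
  proof (rule Topological_Spaces.openI)
    fix z0 assume "z0 \<in> Some -` {x. ?f x \<in> V}"
    then have "?f (Some z0) \<in> V" by simp
    then have "\<forall>\<^sub>F z in nhds z0. ?f (Some z) \<in> V"
      by (rule fin)
    then obtain S where "open S \<and> z0 \<in> S \<and> (\<forall>z\<in>S. ?f (Some z) \<in> V)"
      unfolding eventually_nhds by (rule exE)
    then show "\<exists>S. open S \<and> z0 \<in> S \<and> S \<subseteq> Some -` {x. ?f x \<in> V}"
      by (intro exI[of _ S]) auto
  qed
  then show "openin riemann_sphere {x \<in> topspace riemann_sphere. ?f x \<in> V}"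
    using inf by (simp add: openin_riemann_sphere_iff)
next
  show "quotient_map_of p q \<in> topspace riemann_sphere \<rightarrow> topspace riemann_sphere"
    by simp
qed

lemma sphere_inversion_quotient_map_of:
  assumes "coprime p q"
  shows "sphere_inversion (quotient_map_of p q x) = quotient_map_of q p x"
  using coprime_poly_0[OF assms] coeffs_at_max_degree_nonzero[OF assms]
  by (cases x) (auto simp: quotient_map_of_def sphere_inversion_def Let_def max.commute)

lemma quotient_map_of_sphere_inversion:
  defines "n \<equiv> \<lambda>p q. max (degree p) (degree q)"
  shows "quotient_map_of p q (sphere_inversion (Some z)) =
    quotient_map_of (reversed_poly (n p q) p) (reversed_poly (n p q) q) (Some z)"
proof (cases "z = 0")
  case True
  then show ?thesis
    by (simp add: quotient_map_of_def sphere_inversion_def Let_def n_def poly_reversed_poly_0)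
next
  case False
  then show ?thesis
    using poly_reversed_poly[of p "n p q" "1 / z"] poly_reversed_poly[of q "n p q" "1 / z"]
    by (simp add: quotient_map_of_def sphere_inversion_def n_def)
qed

lemma holomorphic_on_quotient_map_of:
  "(\<lambda>z. the (quotient_map_of p q (Some z))) holomorphic_on {z. quotient_map_of p q (Some z) \<noteq> None}"
proof -
  have "(\<lambda>z. poly p z / poly q z) holomorphic_on {z. poly q z \<noteq> 0}"
    by (intro holomorphic_intros) auto
  then show ?thesis
    by (rule holomorphic_transform[THEN holomorphic_on_subset])
      (auto simp: quotient_map_of_def split: if_splits)
qed

text \<open>
  Inverting the value exchanges \<open>p\<close> and \<open>q\<close>, and inverting the argument reverses both polynomials; so
  in each pair of charts the map is again a quotient of polynomials.
\<close>

lemma rational_function_quotient_map_of: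
  assumes "coprime p q"
  shows "rational_function (quotient_map_of p q)"
  unfolding rational_function_def
  using continuous_map_quotient_map_of[OF assms] holomorphic_on_quotient_map_of
  by (auto simp: sphere_inversion_quotient_map_of[OF assms] quotient_map_of_sphere_inversion)

section \<open>The maximum of the spherical derivative of a quotient\<close>

definition wronskian :: "complex poly \<Rightarrow> complex poly \<Rightarrow> complex poly" where
  "wronskian p q = pderiv p * q - p * pderiv q"

text \<open>
  The spherical derivative of \<open>p/q\<close> after clearing denominators. Unlike the quotient itself, this
  expression is continuous at the poles, which makes it the value there as well.
\<close>

definition spherical_speed :: "complex poly \<Rightarrow> complex poly \<Rightarrow> complex \<Rightarrow> real" where
  "spherical_speed p q z =
     cmod (poly (wronskian p q) z) * (1 + (cmod z)\<^sup>2) / ((cmod (poly p z))\<^sup>2 + (cmod (poly q z))\<^sup>2)"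

lemma spherical_deriv_fin_quotient_map_of:
  assumes "poly q z \<noteq> 0"
  shows "spherical_deriv_fin (quotient_map_of p q) z = spherical_speed p q z"
proof -
  have "open {w. poly q w \<noteq> 0}"
    by (intro open_Collect_neq continuous_intros)
  then have "\<forall>\<^sub>F w in nhds z. poly q w \<noteq> 0"
    using assms eventually_nhds_in_open[of "{w. poly q w \<noteq> 0}" z] by simp
  then have "\<forall>\<^sub>F w in nhds z. the (quotient_map_of p q (Some w)) = poly p w / poly q w"
    by eventually_elim (simp add: quotient_map_of_def)
  then have "deriv (\<lambda>w. the (quotient_map_of p q (Some w))) z = deriv (\<lambda>w. poly p w / poly q w) z"
    by (intro deriv_cong_ev) auto
  also have "\<dots> = poly (wronskian p q) z / (poly q z)\<^sup>2"
    using assms by (intro DERIV_imp_deriv)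
      (auto intro!: derivative_eq_intros simp: wronskian_def power2_eq_square)
  finally have deriv: "deriv (\<lambda>w. the (quotient_map_of p q (Some w))) z =
    poly (wronskian p q) z / (poly q z)\<^sup>2" .
  have val: "the (quotient_map_of p q (Some z)) = poly p z / poly q z"
    using assms by (simp add: quotient_map_of_def)
  have frac: "w / b\<^sup>2 * (s / (1 + (a / b)\<^sup>2)) = w * s / (a\<^sup>2 + b\<^sup>2)" if "b \<noteq> 0" for a b s w :: real
  proof -
    have "1 + (a / b)\<^sup>2 = (a\<^sup>2 + b\<^sup>2) / b\<^sup>2"
      using that by (simp add: power_divide add_divide_distrib)
    then show ?thesis using that by simp
  qed
  show ?thesis
    using assms unfolding spherical_deriv_fin_def spherical_speed_def deriv val
    by (simp only: norm_divide norm_power frac norm_eq_zero not_False_eq_True)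
qed

lemma sum_of_squares_pos:
  assumes "coprime p q"
  shows "(cmod (poly p z))\<^sup>2 + (cmod (poly q z))\<^sup>2 > 0"
  using coprime_poly_0[OF assms, of z] by (auto simp: sum_power2_gt_zero_iff)

lemma continuous_on_spherical_speed:
  assumes "coprime p q"
  shows "continuous_on A (spherical_speed p q)"
  unfolding spherical_speed_def using sum_of_squares_pos[OF assms]
  by (intro continuous_intros) (metis less_irrefl)

lemma spherical_speed_tendsto:
  assumes "coprime p q"
  shows "(spherical_speed p q \<longlongrightarrow> spherical_speed p q z) (at z)"
  using continuous_on_spherical_speed[OF assms, of UNIV]
  by (simp add: continuous_on_def)

text \<open>
  The Euler operator \<open>z p' - n p\<close> kills the monomial of degree \<open>n\<close>. This cancellation is what makes the
  spherical derivative finite at infinity.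
\<close>

lemma degree_euler_le:
  fixes p :: "complex poly"
  assumes "degree p \<le> Suc n"
  shows "degree (monom 1 1 * pderiv p - smult (of_nat (Suc n)) p) \<le> n"
proof (rule degree_le, intro allI impI)
  fix i assume "n < i"
  then obtain k where k: "i = Suc k" "n \<le> k" by (cases i) auto
  show "coeff (monom 1 1 * pderiv p - smult (of_nat (Suc n)) p) i = 0"
  proof (cases "k = n")
    case True
    then show ?thesis using k by (simp add: coeff_monom_mult coeff_pderiv)
  next
    case False
    then have "coeff p (Suc k) = 0" using assms k by (intro coeff_eq_0) auto
    then show ?thesis using k by (simp add: coeff_monom_mult coeff_pderiv)
  qed
qed

text \<open>
  Replacing \<open>z p'\<close> by \<open>z p' - n p\<close>, and likewise for \<open>q\<close>, does not change \<open>z (p' q - p q')\<close>, but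
  lowers the degree of one factor in each product. After division by powers of \<open>z\<close> every factor then has a
  limit, and that of the denominator is nonzero.
\<close>

lemma spherical_speed_converges_at_infinity:
  assumes "coprime p q" and pos: "0 < max (degree p) (degree q)"
  obtains L where "(spherical_speed p q \<longlongrightarrow> L) at_infinity"
proof -
  obtain n where n: "max (degree p) (degree q) = Suc n"
    using pos gr0_conv_Suc by blast
  define E where "E = (\<lambda>r::complex poly. monom 1 1 * pderiv r - smult (of_nat (Suc n)) r)"
  have deg: "degree p \<le> Suc n" "degree q \<le> Suc n"
    using n by simp_all
  define X where "X = (\<lambda>z. (poly (E p) z / z ^ n) * (poly q z / z ^ Suc n)
    - (poly p z / z ^ Suc n) * (poly (E q) z / z ^ n))"
  define Y where "Y = (\<lambda>z. (cmod (poly p z / z ^ Suc n))\<^sup>2 + (cmod (poly q z / z ^ Suc n))\<^sup>2)"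
  define Z where "Z = (\<lambda>z. (cmod (1/z))\<^sup>2 + 1)"
  have "coeff p (Suc n) \<noteq> 0 \<or> coeff q (Suc n) \<noteq> 0"
    using coeffs_at_max_degree_nonzero[OF assms(1)] n by simp
  then have nz: "(cmod (coeff p (Suc n)))\<^sup>2 + (cmod (coeff q (Suc n)))\<^sup>2 \<noteq> 0"
    by (simp add: sum_power2_eq_zero_iff)
  have inv: "((\<lambda>z::complex. 1 / z) \<longlongrightarrow> 0) at_infinity"
    by (rule tendsto_divide_0[OF tendsto_const filterlim_ident])
  have "((\<lambda>z. cmod (X z) * Z z / Y z) \<longlongrightarrow>
     cmod (coeff (E p) n * coeff q (Suc n) - coeff p (Suc n) * coeff (E q) n) * ((cmod 0)\<^sup>2 + 1)
       / ((cmod (coeff p (Suc n)))\<^sup>2 + (cmod (coeff q (Suc n)))\<^sup>2)) at_infinity"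
    unfolding X_def Y_def Z_def
    by (intro tendsto_intros inv poly_over_power_tendsto_coeff deg nz)
      (simp_all only: E_def deg degree_euler_le)
  moreover have "\<forall>\<^sub>F z in at_infinity. cmod (X z) * Z z / Y z = spherical_speed p q z"
    using eventually_not_equal_at_infinity[of 0]
  proof eventually_elim
    case (elim z)
    have X: "X z = poly (wronskian p q) z * z / (z ^ n * z ^ Suc n)"
      using elim by (simp add: X_def E_def wronskian_def poly_monom field_simps)
    have Y: "Y z = ((cmod (poly p z))\<^sup>2 + (cmod (poly q z))\<^sup>2) / (cmod z ^ Suc n)\<^sup>2"
      unfolding Y_def norm_divide norm_power power_divide by (rule add_divide_distrib[symmetric])
    have Z: "Z z = (1 + (cmod z)\<^sup>2) / (cmod z)\<^sup>2"
      using elim by (simp add: Z_def norm_divide power_divide field_simps)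
    have nzz: "cmod z \<noteq> 0" using elim by simp
    show ?case
      unfolding X Y Z spherical_speed_def norm_mult norm_divide norm_power
      using nzz sum_of_squares_pos[OF assms(1), of z]
      by (simp add: divide_simps) (simp add: power2_eq_square algebra_simps)
  qed
  ultimately show ?thesis
    using that tendsto_cong by fast
qed

lemma spherical_deriv_norm_quotient_map_of:
  assumes "coprime p q" and "q \<noteq> 0"
  shows "spherical_deriv_norm (quotient_map_of p q) (Some z) = spherical_speed p q z"
proof (cases "poly q z = 0")
  case False
  then show ?thesis
    using spherical_deriv_fin_quotient_map_of[OF False]
    by (simp add: spherical_deriv_norm_def quotient_map_of_def)
next
  case True
  have "\<forall>\<^sub>F w in at z. poly q w \<noteq> 0"
    using islimpt_finite[OF poly_roots_finite[OF assms(2)], of z]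
    by (simp add: islimpt_iff_eventually)
  then have "\<forall>\<^sub>F w in at z. spherical_deriv_fin (quotient_map_of p q) w = spherical_speed p q w"
    by eventually_elim (rule spherical_deriv_fin_quotient_map_of)
  then have "(spherical_deriv_fin (quotient_map_of p q) \<longlongrightarrow> spherical_speed p q z) (at z)"
    using spherical_speed_tendsto[OF assms(1)] tendsto_cong by fast
  then have "Lim (at z) (spherical_deriv_fin (quotient_map_of p q)) = spherical_speed p q z"
    by (intro tendsto_Lim) auto
  then show ?thesis
    using True by (simp add: spherical_deriv_norm_def quotient_map_of_def)
qed

lemma spherical_deriv_norm_quotient_map_of_infinity:
  assumes "q \<noteq> 0" and "(spherical_speed p q \<longlongrightarrow> L) at_infinity"
  shows "spherical_deriv_norm (quotient_map_of p q) None = L"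
proof -
  have "bounded {z. poly q z = 0}"
    by (intro finite_imp_bounded poly_roots_finite assms(1))
  then obtain b where "\<forall>z\<in>{z. poly q z = 0}. cmod z < b"
    unfolding bounded_pos_less by (elim exE conjE)
  then have "\<forall>\<^sub>F w in at_infinity. poly q w \<noteq> 0"
    by (intro eventually_at_infinityI[of b]) auto
  then have "\<forall>\<^sub>F w in at_infinity. spherical_deriv_fin (quotient_map_of p q) w = spherical_speed p q w"
    by eventually_elim (rule spherical_deriv_fin_quotient_map_of)
  then have "(spherical_deriv_fin (quotient_map_of p q) \<longlongrightarrow> L) at_infinity"
    using assms(2) tendsto_cong by fast
  then show ?thesis
    by (simp add: spherical_deriv_norm_def tendsto_Lim[OF trivial_limit_at_infinity])
qed

text \<open>
  Compactness of the sphere, stated in the plane: a continuous function with a limit at infinity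
  either is dominated by that limit or exceeds it somewhere, and then its maximum over a large disc is
  global.
\<close>

lemma attains_max_on_sphere:
  fixes g :: "complex \<Rightarrow> real"
  assumes cont: "continuous_on UNIV g" and lim: "(g \<longlongrightarrow> L) at_infinity"
  shows "(\<forall>z. g z \<le> L) \<or> (\<exists>z0. L \<le> g z0 \<and> (\<forall>z. g z \<le> g z0))"
proof (cases "\<forall>z. g z \<le> L")
  case False
  then obtain a where a: "L < g a" by (auto simp: not_le)
  with lim have "\<forall>\<^sub>F z in at_infinity. g z < g a"
    by (rule order_tendstoD)
  then obtain R where R: "g z < g a" if "cmod z \<ge> R" for z
    by (auto simp: eventually_at_infinity)
  have "a \<in> cball 0 R"
    using R[of a] by (cases "R \<le> cmod a") auto
  moreover have "\<exists>z0\<in>cball 0 R. \<forall>z\<in>cball 0 R. g z \<le> g z0"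
    by (rule continuous_attains_sup[OF compact_cball _ continuous_on_subset[OF cont subset_UNIV]])
      (use calculation in blast)
  ultimately obtain z0 where aR: "a \<in> cball 0 R"
      and z0: "\<And>z. z \<in> cball 0 R \<Longrightarrow> g z \<le> g z0"
    by blast
  have "g z \<le> g z0" for z
    using z0[of z] z0[OF aR] R[of z] by (cases "cmod z \<le> R") auto
  moreover have "L \<le> g z0"
    using a z0[OF aR] by simp
  ultimately show ?thesis by blast
qed simp

text \<open>
  The maximum in the definition of \<open>K\<close> is attained, so it is bounded by any bound for
  the values. The bound passes to the origin and to infinity by continuity, which admits
  estimates that divide by \<open>|z|\<close>.
\<close>

lemma K_quotient_map_of_le:
  assumes cop: "coprime p q" and "q \<noteq> 0" and pos: "0 < max (degree p) (degree q)"
    and bound: "\<And>z. z \<noteq> 0 \<Longrightarrow> spherical_speed p q z \<le> B"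
  shows "K (quotient_map_of p q) \<le> B"
proof -
  let ?N = "spherical_deriv_norm (quotient_map_of p q)"
  obtain L where L: "(spherical_speed p q \<longlongrightarrow> L) at_infinity"
    using spherical_speed_converges_at_infinity[OF cop pos] .
  have fin: "?N (Some z) = spherical_speed p q z" for z
    by (rule spherical_deriv_norm_quotient_map_of[OF cop assms(2)])
  have inf: "?N None = L"
    by (rule spherical_deriv_norm_quotient_map_of_infinity[OF assms(2) L])
  have "\<forall>\<^sub>F z in at_infinity. spherical_speed p q z \<le> B"
    using eventually_not_equal_at_infinity[of 0] by eventually_elim (rule bound)
  then have "L \<le> B"
    by (rule tendsto_upperbound[OF L _ trivial_limit_at_infinity])
  have "spherical_speed p q 0 \<le> B"
    by (rule tendsto_upperbound[OF spherical_speed_tendsto[OF cop]])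
      (auto simp: eventually_at_filter bound)
  then have "spherical_speed p q z \<le> B" for z
    using bound by (cases "z = 0") auto
  then have le: "?N x \<le> B" for x
    using \<open>L \<le> B\<close> by (cases x) (simp_all add: fin inf)
  obtain x0 where x0: "?N x \<le> ?N x0" for x
    using attains_max_on_sphere[OF continuous_on_spherical_speed[OF cop] L]
  proof
    assume "\<forall>z. spherical_speed p q z \<le> L"
    then have "?N x \<le> ?N None" for x
      by (cases x) (simp_all add: fin inf)
    then show thesis by (rule that)
  next
    assume "\<exists>z0. L \<le> spherical_speed p q z0 \<and> (\<forall>z. spherical_speed p q z \<le> spherical_speed p q z0)"
    then obtain z0 where "L \<le> spherical_speed p q z0"
        "\<forall>z. spherical_speed p q z \<le> spherical_speed p q z0"
      by blast
    then have "?N x \<le> ?N (Some z0)" for x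
      by (cases x) (simp_all add: fin inf)
    then show thesis by (rule that)
  qed
  have "K (quotient_map_of p q) = ?N x0"
    unfolding K_def
  proof (rule Greatest_equality)
    show "?N x0 \<in> range ?N" by (rule rangeI)
    show "m \<le> ?N x0" if "m \<in> range ?N" for m
      using that x0 by (elim rangeE) (simp only:)
  qed
  then show ?thesis using le by simp
qed

section \<open>Sums with geometric decay on both sides\<close>

lemma geometric_sum_tail_le:
  fixes \<theta> :: real
  assumes "0 \<le> \<theta>" "\<theta> < 1" "finite T" "T \<subseteq> {b..}"
  shows "(\<Sum>k\<in>T. \<theta> ^ k) \<le> \<theta> ^ b / (1 - \<theta>)"
proof -
  have eq: "(1 - \<theta>) * (\<Sum>k=b..<b+n. \<theta> ^ k) = \<theta> ^ b - \<theta> ^ (b + n)" for n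
  proof (induction n)
    case (Suc n)
    have step: "(1 - \<theta>) * (\<Sum>k=b..<b + Suc n. \<theta> ^ k)
        = (1 - \<theta>) * (\<Sum>k=b..<b + n. \<theta> ^ k) + (1 - \<theta>) * \<theta> ^ (b + n)"
      by (simp add: distrib_left)
    show ?case
      unfolding step Suc.IH by (simp add: algebra_simps)
  qed simp
  obtain n where n: "T \<subseteq> {..<n}"
    using assms(3) finite_nat_bounded by blast
  have "(\<Sum>k\<in>T. \<theta> ^ k) \<le> (\<Sum>k=b..<b+n. \<theta> ^ k)"
    using assms n by (intro sum_mono2) (auto dest!: subsetD)
  moreover have "(1 - \<theta>) * (\<Sum>k=b..<b+n. \<theta> ^ k) \<le> \<theta> ^ b"
    using assms by (simp add: eq)
  then have "(\<Sum>k=b..<b+n. \<theta> ^ k) \<le> \<theta> ^ b / (1 - \<theta>)"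
    using assms by (simp add: field_simps)
  ultimately show ?thesis by linarith
qed

lemma two_sided_geometric_sum_le:
  fixes \<theta> :: real and j :: nat
  assumes "0 \<le> \<theta>" "\<theta> < 1" "finite S" and far: "\<And>i. i \<in> S \<Longrightarrow> b \<le> (i - j) + (j - i)"
  shows "(\<Sum>i\<in>S. \<theta> ^ ((i - j) + (j - i))) \<le> 2 * \<theta> ^ b / (1 - \<theta>)"
proof -
  let ?f = "\<lambda>i. \<theta> ^ ((i - j) + (j - i))"
  have "S = (S \<inter> {j..}) \<union> (S \<inter> {..<j})" by auto
  then have "sum ?f S = sum ?f (S \<inter> {j..}) + sum ?f (S \<inter> {..<j})"
    using assms(3) by (subst sum.union_disjoint[symmetric]) auto
  also have "sum ?f (S \<inter> {j..}) = (\<Sum>k\<in>(\<lambda>i. i - j) ` (S \<inter> {j..}). \<theta> ^ k)"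
    by (subst sum.reindex) (auto simp: inj_on_def intro!: sum.cong)
  also have "\<dots> \<le> \<theta> ^ b / (1 - \<theta>)"
    using assms(1-3) by (intro geometric_sum_tail_le) (auto dest!: far)
  also have "sum ?f (S \<inter> {..<j}) = (\<Sum>k\<in>(\<lambda>i. j - i) ` (S \<inter> {..<j}). \<theta> ^ k)"
    by (subst sum.reindex) (auto simp: inj_on_def intro!: sum.cong)
  also have "\<dots> \<le> \<theta> ^ b / (1 - \<theta>)"
    using assms(1-3) by (intro geometric_sum_tail_le) (auto dest!: far)
  finally show ?thesis by simp
qed

text \<open>
  The quantities \<open>y l\<close> will be the ratios of consecutive monomials in the direction away from the
  largest one. Only the first ratio may be close to 1. The second estimate bounds the derivative: it is a
  discrete product rule, in which the factor \<open>y l\<close> paired with \<open>D m l\<close> is spent on the mesh bound, while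
  the remaining factors give the decay.
\<close>

lemma products_of_small_ratios:
  fixes y :: "nat \<Rightarrow> real" and m :: "nat \<Rightarrow> nat"
  assumes nonneg: "\<And>l. l < n \<Longrightarrow> 0 \<le> y l" and first: "\<And>l. l < n \<Longrightarrow> y l \<le> 1"
    and later: "\<And>l. l < n \<Longrightarrow> 0 < l \<Longrightarrow> y l \<le> 1 / 4"
    and mesh: "\<And>l. l < n \<Longrightarrow> D * real (m l) * y l \<le> B"
    and "0 \<le> D" "0 \<le> B" and "s \<le> n"
  shows "(\<Prod>l<s. y l) \<le> 4 * (1 / 4) ^ s"
    and "D * real (\<Sum>l<s. m l) * (\<Prod>l<s. y l) \<le> 8 * B * (1 / 2) ^ s"
proof -
  have "0 \<le> (\<Prod>l<s. y l) \<and> (\<Prod>l<s. y l) \<le> 4 * (1 / 4) ^ s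
      \<and> D * real (\<Sum>l<s. m l) * (\<Prod>l<s. y l) \<le> 8 * B * (1 / 2) ^ s"
    using \<open>s \<le> n\<close>
  proof (induction s)
    case 0
    then show ?case using \<open>0 \<le> B\<close> by simp
  next
    case (Suc s)
    let ?u = "\<Prod>l<s. y l" and ?M = "real (\<Sum>l<s. m l)"
    have u: "0 \<le> ?u" "?u \<le> 4 * (1 / 4) ^ s" and a: "D * ?M * ?u \<le> 8 * B * (1 / 2) ^ s"
      and y: "0 \<le> y s" "y s \<le> 1" and my: "D * real (m s) * y s \<le> B"
      using Suc nonneg[of s] first[of s] mesh[of s] by simp_all
    show ?case
    proof (cases "s = 0")
      case True
      then show ?thesis using y my \<open>0 \<le> B\<close> by simp
    next
      case False
      then have y4: "y s \<le> 1 / 4" using later[of s] Suc.prems by simp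
      have "?u * y s \<le> (4 * (1 / 4) ^ s) * (1 / 4)"
        using y y4 by (rule_tac mult_mono[OF u(2)]) auto
      moreover have "(D * ?M * ?u) * y s \<le> (8 * B * (1 / 2) ^ s) * (1 / 4)"
        using y y4 \<open>0 \<le> B\<close> by (rule_tac mult_mono[OF a]) auto
      moreover have "(D * real (m s) * y s) * ?u \<le> B * (4 * (1 / 4) ^ s)"
        using u \<open>0 \<le> B\<close> by (rule_tac mult_mono[OF my]) auto
      \<comment> \<open>Passing from rate 1/4 to rate 1/2 leaves room for the new summand of the product rule.\<close>
      moreover have "B * (4 * (1 / 4) ^ s) \<le> 2 * B * (1 / 2) ^ s"
      proof -
        have "(1 / 2 :: real) ^ s \<le> (1 / 2) ^ 1"
          using False by (intro power_decreasing) auto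
        then have "(1 / 2 :: real) ^ s * (1 / 2) ^ s \<le> (1 / 2) ^ 1 * (1 / 2) ^ s"
          by (intro mult_right_mono) auto
        then have "4 * (1 / 4 :: real) ^ s \<le> 2 * (1 / 2) ^ s"
          by (simp flip: power_mult_distrib)
        then show ?thesis
          using mult_left_mono[OF _ \<open>0 \<le> B\<close>, of "4 * (1 / 4) ^ s" "2 * (1 / 2) ^ s"] by simp
      qed
      ultimately show ?thesis
        using u y by (simp add: algebra_simps)
    qed
  qed
  then show "(\<Prod>l<s. y l) \<le> 4 * (1 / 4) ^ s"
    "D * real (\<Sum>l<s. m l) * (\<Prod>l<s. y l) \<le> 8 * B * (1 / 2) ^ s"
    by simp_all
qed

text \<open>
  The inverse conformal factor \<open>(1 + r\<^sup>2) / r\<close> may blow up as \<open>r\<close> tends to 0 or infinity. A ratio of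
  consecutive monomials compensates for this, because its exponent is at least 1: the product is monotone
  in \<open>r\<close>, and so is largest at the radius \<open>\<rho>\<close> where the two monomials have equal modulus.
\<close>

lemma conformal_factor_below:
  fixes r \<rho> :: real
  assumes "0 < r" "r \<le> \<rho>" "0 < m"
  shows "(r + 1 / r) * (r / \<rho>) ^ m \<le> \<rho> + 1 / \<rho>"
proof -
  have "(r / \<rho>) ^ m \<le> (r / \<rho>) ^ 1"
    using assms by (intro power_decreasing) auto
  then have "(r + 1 / r) * (r / \<rho>) ^ m \<le> (r + 1 / r) * (r / \<rho>)"
    using assms by (intro mult_left_mono) auto
  also have "\<dots> = r * r / \<rho> + 1 / \<rho>"
    using assms by (simp add: field_simps)
  also have "r * r / \<rho> \<le> \<rho> * \<rho> / \<rho>"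
    using assms by (intro divide_right_mono mult_mono) auto
  finally show ?thesis using assms by simp
qed

lemma conformal_factor_above:
  fixes r \<rho> :: real
  assumes "0 < \<rho>" "\<rho> \<le> r" "0 < m"
  shows "(r + 1 / r) * (\<rho> / r) ^ m \<le> \<rho> + 1 / \<rho>"
  using conformal_factor_below[of "1 / r" "1 / \<rho>" m] assms
  by (simp add: frac_le add.commute)

section \<open>Sums of monomials with separated peaks\<close>

text \<open>
  The monomials are \<open>c\<^sub>i z^(k\<^sub>i)\<close> for \<open>i \<le> N\<close>; the gap \<open>m l\<close> is the difference of the exponents number
  \<open>l\<close> and \<open>l + 1\<close>, and \<open>\<rho> l\<close> is the radius at which these two monomials have equal modulus. The two
  gap conditions say that the ratio of consecutive monomials changes by a factor 4 at least
  from one such radius to the next, which separates the peaks. The mesh condition says that an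
  exponent gap at radius \<open>\<rho>\<close> does not exceed \<open>B\<close> times the spherical length scale \<open>\<rho> / (1 + \<rho>\<^sup>2)\<close>; it limits
  the speed with which the argument of a ratio of neighbouring monomials turns.
\<close>

locale spaced_monomials =
  fixes \<rho> :: "nat \<Rightarrow> real" and m :: "nat \<Rightarrow> nat" and N :: nat and B :: real
  assumes rho_pos: "l < N \<Longrightarrow> 0 < \<rho> l"
    and m_pos: "l < N \<Longrightarrow> 0 < m l"
    and gap_left: "Suc l < N \<Longrightarrow> (\<rho> l / \<rho> (Suc l)) ^ m l \<le> 1 / 4"
    and gap_right: "Suc l < N \<Longrightarrow> (\<rho> l / \<rho> (Suc l)) ^ m (Suc l) \<le> 1 / 4"
    and mesh: "l < N \<Longrightarrow> real (m l) * (\<rho> l + 1 / \<rho> l) \<le> B"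
    and B_nonneg: "0 \<le> B"
begin

definition exponent :: "nat \<Rightarrow> nat" where "exponent i = (\<Sum>l<i. m l)"

text \<open>
  Normalized so that the monomials number \<open>l\<close> and \<open>l + 1\<close> agree in modulus at radius \<open>\<rho> l\<close>.
\<close>

definition coefficient :: "nat \<Rightarrow> real" where "coefficient i = (\<Prod>l<i. (1 / \<rho> l) ^ m l)"

definition magnitude :: "real \<Rightarrow> nat \<Rightarrow> real" where "magnitude r i = coefficient i * r ^ exponent i"

definition subsum :: "nat set \<Rightarrow> complex poly" where
  "subsum S = (\<Sum>i\<in>S. monom (complex_of_real (coefficient i)) (exponent i))"

text \<open>
  At radius \<open>r\<close> the moduli of the monomials do not decrease up to number \<open>j\<close> and do not increase from there
  on, so that number \<open>j\<close> has the largest modulus.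
\<close>

definition dominant :: "real \<Rightarrow> nat \<Rightarrow> bool" where
  "dominant r j \<longleftrightarrow> j \<le> N \<and> (\<forall>l<j. \<rho> l \<le> r) \<and> (\<forall>l. j \<le> l \<longrightarrow> l < N \<longrightarrow> r \<le> \<rho> l)"

lemma coefficient_pos: "i \<le> N \<Longrightarrow> 0 < coefficient i"
  unfolding coefficient_def by (intro prod_pos) (use rho_pos in auto)

lemma magnitude_pos: "i \<le> N \<Longrightarrow> 0 < r \<Longrightarrow> 0 < magnitude r i"
  by (simp add: magnitude_def coefficient_pos)

lemma magnitude_nonneg: "i \<le> N \<Longrightarrow> 0 \<le> r \<Longrightarrow> 0 \<le> magnitude r i"
  by (simp add: magnitude_def coefficient_pos less_imp_le)

lemma magnitude_Suc: "magnitude r (Suc i) = magnitude r i * (r / \<rho> i) ^ m i"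
  by (simp add: magnitude_def coefficient_def exponent_def power_add power_divide)

lemma exponent_strict_mono:
  assumes "i < j" "j \<le> N" shows "exponent i < exponent j"
proof -
  have "exponent j = exponent i + (\<Sum>l=i..<j. m l)"
    using assms unfolding exponent_def lessThan_atLeast0 by (simp add: sum.atLeastLessThan_concat)
  moreover have "0 < (\<Sum>l=i..<j. m l)"
    using assms m_pos[of i] by (intro sum_pos2[of _ i]) auto
  ultimately show ?thesis by simp
qed

lemma rho_mono:
  assumes "i \<le> j" "j < N" shows "\<rho> i \<le> \<rho> j"
  using assms
proof (induction j rule: dec_induct)
  case (step l)
  have "\<rho> l \<le> \<rho> (Suc l)"
  proof (rule ccontr)
    assume "\<not> \<rho> l \<le> \<rho> (Suc l)"
    then have "1 \<le> \<rho> l / \<rho> (Suc l)"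
      using step.prems rho_pos[of "Suc l"] by simp
    then have "1 \<le> (\<rho> l / \<rho> (Suc l)) ^ m l"
      by (rule one_le_power)
    then show False using gap_left[OF step.prems] by simp
  qed
  then show ?case using step by simp
qed simp

lemma exists_dominant: "\<exists>j. dominant r j"
proof -
  define j where "j = (LEAST j. j = N \<or> r \<le> \<rho> j)"
  have j: "j = N \<or> r \<le> \<rho> j"
    unfolding j_def by (rule LeastI[of _ N]) simp
  have "j \<le> N"
    unfolding j_def by (rule Least_le) simp
  moreover have "\<rho> l \<le> r" if "l < j" for l
    using not_less_Least[of l "\<lambda>j. j = N \<or> r \<le> \<rho> j"] that by (simp add: j_def)
  moreover have "r \<le> \<rho> l" if "j \<le> l" "l < N" for l
    using rho_mono[OF that] j that by auto
  ultimately show ?thesis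
    unfolding dominant_def by blast
qed

lemma decay_forward:
  assumes "dominant r j" "0 < r" "j + s \<le> N"
  shows "magnitude r (j + s) \<le> 4 * (1 / 4) ^ s * magnitude r j"
    and "(r + 1 / r) * (real (exponent (j + s)) - real (exponent j)) * magnitude r (j + s)
          \<le> 8 * B * (1 / 2) ^ s * magnitude r j"
proof -
  define y where "y l = (r / \<rho> (j + l)) ^ m (j + l)" for l
  have le: "r \<le> \<rho> (j + l)" if "l < N - j" for l
    using assms(1) that by (auto simp: dominant_def)
  have pos: "0 < \<rho> (j + l)" "0 < m (j + l)" if "l < N - j" for l
    using that rho_pos[of "j + l"] m_pos[of "j + l"] by simp_all
  have 1: "0 \<le> y l" if "l < N - j" for l
    using pos[OF that] assms(2) by (simp add: y_def)
  have 2: "y l \<le> 1" if "l < N - j" for l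
    using pos[OF that] le[OF that] assms(2) by (simp add: y_def power_le_one)
  \<comment> \<open>The interval between the radii number \<open>j + l - 1\<close> and \<open>j + l\<close> lies beyond \<open>r\<close>.\<close>
  have 3: "y l \<le> 1 / 4" if "l < N - j" "0 < l" for l
  proof -
    obtain l' where l': "l = Suc l'" using \<open>0 < l\<close> gr0_conv_Suc by blast
    have "y l \<le> (\<rho> (j + l') / \<rho> (j + l)) ^ m (j + l)"
      unfolding y_def using pos[OF that(1)] le[of l'] assms(2) that l'
      by (intro power_mono divide_right_mono) auto
    also have "\<dots> \<le> 1 / 4"
      using gap_right[of "j + l'"] that l' by simp
    finally show ?thesis .
  qed
  have 4: "(r + 1 / r) * real (m (j + l)) * y l \<le> B" if "l < N - j" for l
  proof -
    have "(r + 1 / r) * real (m (j + l)) * y l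
        = real (m (j + l)) * ((r + 1 / r) * (r / \<rho> (j + l)) ^ m (j + l))"
      by (simp add: y_def)
    also have "\<dots> \<le> real (m (j + l)) * (\<rho> (j + l) + 1 / \<rho> (j + l))"
      using conformal_factor_below[OF assms(2) le[OF that] pos(2)[OF that]]
      by (intro mult_left_mono) auto
    also have "\<dots> \<le> B" using mesh[of "j + l"] that by simp
    finally show ?thesis .
  qed
  have magnitude: "magnitude r (j + s) = magnitude r j * (\<Prod>l<s. y l)"
    by (induction s) (simp_all add: magnitude_Suc y_def)
  have exponent: "exponent (j + s) = exponent j + (\<Sum>l<s. m (j + l))"
    by (induction s) (simp_all add: exponent_def)
  have s: "0 \<le> magnitude r j"
    using assms by (simp add: magnitude_nonneg)
  have D: "0 \<le> r + 1 / r" using assms(2) by simp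
  have "s \<le> N - j" using assms(3) by simp
  note prods = products_of_small_ratios[where y = y and m = "\<lambda>l. m (j + l)" and D = "r + 1 / r",
      OF 1 2 3 4 D B_nonneg this]
  show "magnitude r (j + s) \<le> 4 * (1 / 4) ^ s * magnitude r j"
    using mult_left_mono[OF prods(1) s] by (simp add: magnitude mult.commute)
  have "(r + 1 / r) * (real (exponent (j + s)) - real (exponent j)) * magnitude r (j + s)
      = magnitude r j * ((r + 1 / r) * real (\<Sum>l<s. m (j + l)) * (\<Prod>l<s. y l))"
    by (simp add: magnitude exponent mult_ac)
  also have "\<dots> \<le> magnitude r j * (8 * B * (1 / 2) ^ s)"
    by (rule mult_left_mono[OF prods(2) s])
  finally show "(r + 1 / r) * (real (exponent (j + s)) - real (exponent j)) * magnitude r (j + s)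
      \<le> 8 * B * (1 / 2) ^ s * magnitude r j"
    by (simp add: mult_ac)
qed

lemma decay_backward:
  assumes "dominant r j" "0 < r" "s \<le> j"
  shows "magnitude r (j - s) \<le> 4 * (1 / 4) ^ s * magnitude r j"
    and "(r + 1 / r) * (real (exponent j) - real (exponent (j - s))) * magnitude r (j - s)
          \<le> 8 * B * (1 / 2) ^ s * magnitude r j"
proof -
  define i where "i l = j - Suc l" for l
  define y where "y l = (\<rho> (i l) / r) ^ m (i l)" for l
  have i: "i l < N" "\<rho> (i l) \<le> r" if "l < j" for l
    using assms(1) that by (auto simp: dominant_def i_def)
  have pos: "0 < \<rho> (i l)" "0 < m (i l)" if "l < j" for l
    using i(1)[OF that] rho_pos m_pos by simp_all
  have 1: "0 \<le> y l" if "l < j" for l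
    using pos(1)[OF that] assms(2) by (simp add: y_def)
  have 2: "y l \<le> 1" if "l < j" for l
    using pos(1)[OF that] i(2)[OF that] assms(2) by (simp add: y_def power_le_one)
  have 3: "y l \<le> 1 / 4" if "l < j" "0 < l" for l
  proof -
    have next_index: "Suc (i l) < j" using that by (simp add: i_def)
    then have "Suc (i l) < N" "\<rho> (Suc (i l)) \<le> r"
      using assms(1) by (auto simp: dominant_def)
    then have "y l \<le> (\<rho> (i l) / \<rho> (Suc (i l))) ^ m (i l)"
      unfolding y_def using pos[OF that(1)] rho_pos[of "Suc (i l)"] assms(2)
      by (intro power_mono divide_left_mono) auto
    also have "\<dots> \<le> 1 / 4"
      by (rule gap_left) fact
    finally show ?thesis .
  qed
  have 4: "(r + 1 / r) * real (m (i l)) * y l \<le> B" if "l < j" for l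
  proof -
    have "(r + 1 / r) * real (m (i l)) * y l
        = real (m (i l)) * ((r + 1 / r) * (\<rho> (i l) / r) ^ m (i l))"
      by (simp add: y_def)
    also have "\<dots> \<le> real (m (i l)) * (\<rho> (i l) + 1 / \<rho> (i l))"
      using conformal_factor_above[OF pos(1)[OF that] i(2)[OF that] pos(2)[OF that]]
      by (intro mult_left_mono) auto
    also have "\<dots> \<le> B" using mesh i(1)[OF that] by simp
    finally show ?thesis .
  qed
  have magnitude: "magnitude r (j - t) = magnitude r j * (\<Prod>l<t. y l)" if "t \<le> j" for t
    using that
  proof (induction t)
    case (Suc t)
    then have "j - t = Suc (i t)" "t < j" by (simp_all add: i_def)
    then have "magnitude r (j - t) * y t = magnitude r (i t)"
      using pos(1)[of t] assms(2) by (simp add: magnitude_Suc y_def power_divide)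
    then show ?case using Suc by (simp add: i_def)
  qed simp
  have exponent: "exponent j = exponent (j - t) + (\<Sum>l<t. m (i l))" if "t \<le> j" for t
    using that
  proof (induction t)
    case (Suc t)
    then have "j - t = Suc (i t)" by (simp add: i_def)
    then have "exponent (j - t) = exponent (i t) + m (i t)" by (simp add: exponent_def)
    then show ?case using Suc by (simp add: i_def)
  qed simp
  have s: "0 \<le> magnitude r j"
    using assms by (simp add: magnitude_nonneg dominant_def)
  have D: "0 \<le> r + 1 / r" using assms(2) by simp
  note prods = products_of_small_ratios[where y = y and m = "\<lambda>l. m (i l)" and D = "r + 1 / r",
      OF 1 2 3 4 D B_nonneg assms(3)]
  show "magnitude r (j - s) \<le> 4 * (1 / 4) ^ s * magnitude r j"
    using mult_left_mono[OF prods(1) s] by (simp add: magnitude[OF assms(3)] mult.commute)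
  have "(r + 1 / r) * (real (exponent j) - real (exponent (j - s))) * magnitude r (j - s)
      = magnitude r j * ((r + 1 / r) * real (\<Sum>l<s. m (i l)) * (\<Prod>l<s. y l))"
    unfolding magnitude[OF assms(3)] using exponent[OF assms(3)] by (simp add: mult_ac)
  also have "\<dots> \<le> magnitude r j * (8 * B * (1 / 2) ^ s)"
    by (rule mult_left_mono[OF prods(2) s])
  finally show "(r + 1 / r) * (real (exponent j) - real (exponent (j - s))) * magnitude r (j - s)
      \<le> 8 * B * (1 / 2) ^ s * magnitude r j"
    by (simp add: mult_ac)
qed

text \<open>
  Going up or down from the dominant monomial, each step after the first one crosses a whole interval
  between consecutive radii \<open>\<rho> l\<close>. Therefore at most one neighbour on each side is comparable with
  the dominant monomial.
\<close>

lemma decay: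
  assumes "dominant r j" "0 < r" "i \<le> N"
  shows "magnitude r i \<le> 4 * (1 / 4) ^ ((i - j) + (j - i)) * magnitude r j"
    and "(r + 1 / r) * \<bar>real (exponent i) - real (exponent j)\<bar> * magnitude r i
          \<le> 8 * B * (1 / 2) ^ ((i - j) + (j - i)) * magnitude r j"
proof -
  have "magnitude r i \<le> 4 * (1 / 4) ^ ((i - j) + (j - i)) * magnitude r j
    \<and> (r + 1 / r) * \<bar>real (exponent i) - real (exponent j)\<bar> * magnitude r i
          \<le> 8 * B * (1 / 2) ^ ((i - j) + (j - i)) * magnitude r j"
  proof (cases "j \<le> i")
    case True
    then obtain s where s: "i = j + s" using le_Suc_ex by blast
    then have "exponent j \<le> exponent i"
      using exponent_strict_mono[of j i] assms(3) by (cases "s = 0") auto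
    then show ?thesis
      using decay_forward[OF assms(1,2), of s] assms(3) s by simp
  next
    case False
    then have "exponent i < exponent j"
      using exponent_strict_mono[of i j] assms(1) by (auto simp: dominant_def)
    moreover have "i = j - (j - i)" using False by simp
    ultimately show ?thesis
      using decay_backward[OF assms(1,2), of "j - i"] False by simp
  qed
  then show "magnitude r i \<le> 4 * (1 / 4) ^ ((i - j) + (j - i)) * magnitude r j"
    "(r + 1 / r) * \<bar>real (exponent i) - real (exponent j)\<bar> * magnitude r i
          \<le> 8 * B * (1 / 2) ^ ((i - j) + (j - i)) * magnitude r j"
    by blast+
qed

lemma sum_magnitudes_le:
  assumes "dominant r j" "0 < r" "S \<subseteq> {..N}" and far: "\<And>i. i \<in> S \<Longrightarrow> b \<le> (i - j) + (j - i)"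
  shows "(\<Sum>i\<in>S. magnitude r i) \<le> 32 / 3 * (1 / 4) ^ b * magnitude r j"
proof -
  have fin: "finite S" using assms(3) finite_subset by blast
  have "(\<Sum>i\<in>S. magnitude r i) \<le> (\<Sum>i\<in>S. 4 * (1 / 4) ^ ((i - j) + (j - i)) * magnitude r j)"
    using assms by (intro sum_mono decay) auto
  also have "\<dots> = 4 * magnitude r j * (\<Sum>i\<in>S. (1 / 4) ^ ((i - j) + (j - i)))"
    by (simp add: sum_distrib_left mult_ac)
  also have "\<dots> \<le> 4 * magnitude r j * (2 * (1 / 4) ^ b / (1 - 1 / 4))"
    using assms(1,2) far fin
    by (intro mult_left_mono two_sided_geometric_sum_le) (auto simp: magnitude_nonneg dominant_def)
  finally show ?thesis by (simp add: mult_ac)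
qed

text \<open>
  Bounds the derivatives. Exponents are measured from the dominant one, since subtracting a common
  multiple of the identity from the Euler operator \<open>z d/dz\<close> does not affect a Wronskian.
\<close>

lemma sum_weighted_magnitudes_le:
  assumes "dominant r j" "0 < r"
  shows "(r + 1 / r) * (\<Sum>i\<le>N. \<bar>real (exponent i) - real (exponent j)\<bar> * magnitude r i) \<le> 32 * B * magnitude r j"
proof -
  have "(r + 1 / r) * (\<Sum>i\<le>N. \<bar>real (exponent i) - real (exponent j)\<bar> * magnitude r i)
      = (\<Sum>i\<le>N. (r + 1 / r) * \<bar>real (exponent i) - real (exponent j)\<bar> * magnitude r i)"
    by (simp add: sum_distrib_left mult_ac)
  also have "\<dots> \<le> (\<Sum>i\<le>N. 8 * B * (1 / 2) ^ ((i - j) + (j - i)) * magnitude r j)"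
    using assms by (intro sum_mono decay) auto
  also have "\<dots> = 8 * B * magnitude r j * (\<Sum>i\<le>N. (1 / 2) ^ ((i - j) + (j - i)))"
    by (simp add: sum_distrib_left mult_ac)
  also have "\<dots> \<le> 8 * B * magnitude r j * (2 * (1 / 2) ^ 0 / (1 - 1 / 2))"
    using assms B_nonneg
    by (intro mult_left_mono two_sided_geometric_sum_le) (auto simp: magnitude_nonneg dominant_def)
  finally show ?thesis by (simp add: mult_ac)
qed

lemma poly_subsum: "poly (subsum S) z = (\<Sum>i\<in>S. complex_of_real (coefficient i) * z ^ exponent i)"
  by (simp add: subsum_def poly_sum poly_monom)

lemma norm_term: "i \<le> N \<Longrightarrow> cmod (complex_of_real (coefficient i) * z ^ exponent i) = magnitude (cmod z) i"
  using coefficient_pos[of i] by (simp add: magnitude_def norm_mult norm_power)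

lemma norm_poly_subsum_le:
  assumes "S \<subseteq> {..N}"
  shows "cmod (poly (subsum S) z) \<le> (\<Sum>i\<in>S. magnitude (cmod z) i)"
  unfolding poly_subsum using assms by (intro sum_norm_le) (simp add: norm_term subset_iff)

lemma norm_euler_subsum_le:
  assumes "S \<subseteq> {..N}"
  shows "cmod (z * poly (pderiv (subsum S)) z - of_nat (exponent j) * poly (subsum S) z)
    \<le> (\<Sum>i\<in>S. \<bar>real (exponent i) - real (exponent j)\<bar> * magnitude (cmod z) i)"
proof -
  have monom: "z * (of_nat n * a * z ^ (n - Suc 0)) = of_nat n * (a * z ^ n)" for n and a :: complex
    by (cases n) simp_all
  have "pderiv (subsum S) = (\<Sum>i\<in>S. pderiv (monom (complex_of_real (coefficient i)) (exponent i)))"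
    using higher_pderiv_sum[of 1] by (simp add: subsum_def)
  then have "z * poly (pderiv (subsum S)) z = (\<Sum>i\<in>S. of_nat (exponent i) * (complex_of_real (coefficient i) * z ^ exponent i))"
    by (simp add: poly_sum poly_monom pderiv_monom sum_distrib_left monom)
  then have "z * poly (pderiv (subsum S)) z - of_nat (exponent j) * poly (subsum S) z
      = (\<Sum>i\<in>S. (of_nat (exponent i) - of_nat (exponent j)) * (complex_of_real (coefficient i) * z ^ exponent i))"
    by (simp add: poly_subsum sum_distrib_left left_diff_distrib flip: sum_subtractf)
  also have "cmod \<dots> \<le> (\<Sum>i\<in>S. \<bar>real (exponent i) - real (exponent j)\<bar> * magnitude (cmod z) i)"
  proof (rule sum_norm_le)
    fix i assume "i \<in> S"
    have "cmod (of_nat (exponent i) - of_nat (exponent j)) = cmod (complex_of_real (real (exponent i) - real (exponent j)))"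
      by simp
    also have "\<dots> = \<bar>real (exponent i) - real (exponent j)\<bar>"
      by (rule norm_of_real)
    finally show "cmod ((of_nat (exponent i) - of_nat (exponent j)) * (complex_of_real (coefficient i) * z ^ exponent i))
        \<le> \<bar>real (exponent i) - real (exponent j)\<bar> * magnitude (cmod z) i"
      using \<open>i \<in> S\<close> assms by (simp only: norm_mult[of "of_nat (exponent i) - of_nat (exponent j)"]) 
        (simp add: norm_term subset_iff)
  qed
  finally show ?thesis .
qed

text \<open>
  A partial sum that contains the dominant monomial but neither of its neighbours is comparable with that
  monomial: the remaining terms add up to at most 2/3 of it.
\<close>

lemma norm_poly_subsum_ge:
  assumes dom: "dominant (cmod z) j" and "z \<noteq> 0" and S: "S \<subseteq> {..N}" "j \<in> S"
    and far: "\<And>i. i \<in> S - {j} \<Longrightarrow> 2 \<le> (i - j) + (j - i)"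
  shows "magnitude (cmod z) j / 3 \<le> cmod (poly (subsum S) z)"
proof -
  let ?t = "\<lambda>i. complex_of_real (coefficient i) * z ^ exponent i"
  have "finite S" using S finite_subset by blast
  then have split: "poly (subsum S) z = ?t j + (\<Sum>i\<in>S - {j}. ?t i)"
    using S(2) by (simp add: poly_subsum sum.remove)
  have "cmod (\<Sum>i\<in>S - {j}. ?t i) \<le> (\<Sum>i\<in>S - {j}. magnitude (cmod z) i)"
    using S by (intro sum_norm_le) (auto simp: norm_term subset_iff)
  also have "\<dots> \<le> 32 / 3 * (1 / 4) ^ 2 * magnitude (cmod z) j"
    using dom \<open>z \<noteq> 0\<close> S(1) far by (intro sum_magnitudes_le) auto
  finally have "cmod (\<Sum>i\<in>S - {j}. ?t i) \<le> 2 / 3 * magnitude (cmod z) j"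
    by (simp add: power2_eq_square)
  moreover have "cmod (?t j) = magnitude (cmod z) j"
    using S by (intro norm_term) auto
  ultimately show ?thesis
    using norm_diff_ineq[of "?t j" "\<Sum>i\<in>S - {j}. ?t i"] unfolding split by linarith
qed

text \<open>
  Distributing the monomials alternately separates neighbours. At each radius, the polynomial that
  contains the dominant monomial contains no other monomial of comparable modulus, so it is bounded away from
  zero; this is why the two polynomials are not small simultaneously.
\<close>

definition numerator :: "complex poly" where "numerator = subsum {i. i \<le> N \<and> even i}"

definition denominator :: "complex poly" where "denominator = subsum {i. i \<le> N \<and> odd i}"

lemma sum_of_squares_lower_bound:
  assumes "dominant (cmod z) j" "z \<noteq> 0"
  shows "(magnitude (cmod z) j / 3)\<^sup>2 \<le> (cmod (poly numerator z))\<^sup>2 + (cmod (poly denominator z))\<^sup>2"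
proof -
  have j: "j \<le> N" using assms(1) by (simp add: dominant_def)
  have s: "0 \<le> magnitude (cmod z) j / 3" using j by (simp add: magnitude_nonneg)
  have far: "2 \<le> (i - j) + (j - i)" if "even i = even j" "i \<noteq> j" for i
    using that by presburger
  show ?thesis
  proof (cases "even j")
    case True
    have "magnitude (cmod z) j / 3 \<le> cmod (poly numerator z)"
      unfolding numerator_def by (rule norm_poly_subsum_ge[OF assms]) (use True j far in auto)
    then have "(magnitude (cmod z) j / 3)\<^sup>2 \<le> (cmod (poly numerator z))\<^sup>2"
      by (rule power_mono[OF _ s])
    then show ?thesis by (simp add: add_increasing2)
  next
    case False
    have "magnitude (cmod z) j / 3 \<le> cmod (poly denominator z)"
      unfolding denominator_def by (rule norm_poly_subsum_ge[OF assms]) (use False j far in auto)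
    then have "(magnitude (cmod z) j / 3)\<^sup>2 \<le> (cmod (poly denominator z))\<^sup>2"
      by (rule power_mono[OF _ s])
    then show ?thesis by (simp add: add_increasing)
  qed
qed

text \<open>
  With \<open>a = z p' - k\<^sub>j p\<close> and \<open>b = z q' - k\<^sub>j q\<close>, where \<open>j\<close> is the dominant index, \<open>z\<close> times the Wronskian
  is \<open>a q - p b\<close>. The decay bounds \<open>p\<close> and \<open>q\<close>, as well as \<open>a\<close> and \<open>b\<close> times \<open>|z| + 1 / |z|\<close>, by multiples of the dominant monomial, whose square
  cancels against the lower bound for \<open>|p|\<^sup>2 + |q|\<^sup>2\<close>.
\<close>

lemma spherical_speed_le:
  assumes "z \<noteq> 0"
  shows "spherical_speed numerator denominator z \<le> 3072 * B"
proof -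
  define r where "r = cmod z"
  have r: "0 < r" using assms by (simp add: r_def)
  obtain j where dom: "dominant r j" using exists_dominant by blast
  define s where "s = magnitude r j"
  have s: "0 < s" using dom r by (simp add: s_def magnitude_pos dominant_def)
  define V where "V S = (\<Sum>i\<in>S. magnitude r i)" for S
  define U where "U S = (\<Sum>i\<in>S. \<bar>real (exponent i) - real (exponent j)\<bar> * magnitude r i)" for S
  let ?E = "{i. i \<le> N \<and> even i}" and ?O = "{i. i \<le> N \<and> odd i}"
  define a where "a = z * poly (pderiv numerator) z - of_nat (exponent j) * poly numerator z"
  define b where "b = z * poly (pderiv denominator) z - of_nat (exponent j) * poly denominator z"
  have EO: "{..N} = ?E \<union> ?O" "?E \<inter> ?O = {}" by auto
  have V: "V {..N} = V ?E + V ?O" and U: "U {..N} = U ?E + U ?O"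
    unfolding V_def U_def EO(1) by (subst sum.union_disjoint; auto)+
  have nonneg: "0 \<le> V S" "0 \<le> U S" if "S \<subseteq> {..N}" for S
    using that r by (auto simp: V_def U_def intro!: sum_nonneg mult_nonneg_nonneg magnitude_nonneg)
  have EN: "?E \<subseteq> {..N}" and ON: "?O \<subseteq> {..N}" by auto
  have p: "cmod (poly numerator z) \<le> V ?E" and q: "cmod (poly denominator z) \<le> V ?O"
    unfolding V_def r_def numerator_def denominator_def by (intro norm_poly_subsum_le EN ON)+
  have ab: "cmod a \<le> U ?E" "cmod b \<le> U ?O"
    unfolding U_def r_def a_def b_def numerator_def denominator_def by (intro norm_euler_subsum_le EN ON)+
  have W: "z * poly (wronskian numerator denominator) z = a * poly denominator z - poly numerator z * b"
    by (simp add: wronskian_def a_def b_def algebra_simps)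
  have "r * cmod (poly (wronskian numerator denominator) z) = cmod (a * poly denominator z - poly numerator z * b)"
    unfolding r_def W[symmetric] by (simp add: norm_mult)
  also have "\<dots> \<le> cmod a * cmod (poly denominator z) + cmod (poly numerator z) * cmod b"
    using norm_triangle_ineq4[of "a * poly denominator z" "poly numerator z * b"] by (simp add: norm_mult)
  also have "\<dots> \<le> U ?E * V ?O + V ?E * U ?O"
    using p q ab nonneg[OF EN] nonneg[OF ON] by (intro add_mono mult_mono) auto
  also have "\<dots> \<le> U {..N} * V {..N}"
    using nonneg[OF EN] nonneg[OF ON] unfolding U V by (simp add: algebra_simps)
  finally have W_le: "r * cmod (poly (wronskian numerator denominator) z) \<le> U {..N} * V {..N}" .
  have "cmod (poly (wronskian numerator denominator) z) * (1 + r\<^sup>2)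
      = (r + 1 / r) * (r * cmod (poly (wronskian numerator denominator) z))"
    using r by (simp add: field_simps power2_eq_square)
  also have "\<dots> \<le> (r + 1 / r) * (U {..N} * V {..N})"
    using W_le r by (intro mult_left_mono) auto
  also have "\<dots> = ((r + 1 / r) * U {..N}) * V {..N}" by simp
  \<comment> \<open>The constant is \<open>32 \<cdot> 32/3 \<cdot> 9\<close>, the factor 9 being due to the loss of 3 in the lower bound.\<close>
  also have "\<dots> \<le> (32 * B * s) * (32 / 3 * (1 / 4) ^ 0 * s)"
    unfolding U_def V_def s_def
    using dom r B_nonneg nonneg[of "{..N}", unfolded V_def]
    by (intro mult_mono sum_weighted_magnitudes_le sum_magnitudes_le) (auto simp: magnitude_nonneg dominant_def)
  also have "\<dots> = 3072 * B * (s / 3)\<^sup>2"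
    by (simp add: power2_eq_square)
  also have "\<dots> \<le> 3072 * B * ((cmod (poly numerator z))\<^sup>2 + (cmod (poly denominator z))\<^sup>2)"
    unfolding s_def r_def using sum_of_squares_lower_bound[OF dom[unfolded r_def] assms] B_nonneg
    by (intro mult_left_mono) auto
  finally have "cmod (poly (wronskian numerator denominator) z) * (1 + (cmod z)\<^sup>2)
      \<le> 3072 * B * ((cmod (poly numerator z))\<^sup>2 + (cmod (poly denominator z))\<^sup>2)"
    by (simp add: r_def)
  moreover have "0 < (cmod (poly numerator z))\<^sup>2 + (cmod (poly denominator z))\<^sup>2"
    using sum_of_squares_lower_bound[OF dom[unfolded r_def] assms] s
    by (rule_tac less_le_trans[of _ "(s / 3)\<^sup>2"]) (auto simp: s_def r_def)
  ultimately show ?thesis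
    by (simp add: spherical_speed_def pos_divide_le_eq)
qed

lemma coprime_numerator_denominator: "coprime numerator denominator"
proof (rule coprime_if_no_common_root)
  fix z show "poly numerator z \<noteq> 0 \<or> poly denominator z \<noteq> 0"
  proof (cases "z = 0")
    case True
    have "exponent i \<noteq> 0" if "0 < i" "i \<le> N" for i
      using exponent_strict_mono[OF that] by simp
    then have "poly numerator 0 = (\<Sum>i\<in>{i. i \<le> N \<and> even i}. if i = 0 then 1 else 0)"
      unfolding numerator_def poly_subsum by (intro sum.cong) (auto simp: coefficient_def exponent_def[of 0])
    also have "\<dots> = 1" by simp
    finally show ?thesis using True by simp
  next
    case False
    obtain j where dom: "dominant (cmod z) j" using exists_dominant by blast
    then have "0 < magnitude (cmod z) j"
      using False by (simp add: magnitude_pos dominant_def)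
    then have "0 < (magnitude (cmod z) j / 3)\<^sup>2" by simp
    then have "0 < (cmod (poly numerator z))\<^sup>2 + (cmod (poly denominator z))\<^sup>2"
      using sum_of_squares_lower_bound[OF dom False] by linarith
    then show ?thesis by auto
  qed
qed

lemma degree_subsum_le: "S \<subseteq> {..N} \<Longrightarrow> degree (subsum S) \<le> exponent N"
  unfolding subsum_def
proof (rule degree_sum_le)
  fix i assume "S \<subseteq> {..N}" "i \<in> S"
  then have "exponent i \<le> exponent N"
    using exponent_strict_mono[of i N] by (cases "i = N") auto
  then show "degree (monom (complex_of_real (coefficient i)) (exponent i)) \<le> exponent N"
    using degree_monom_le le_trans by blast
qed (auto intro: finite_subset)

lemma degree_numerator_le: "degree numerator \<le> exponent N"
  unfolding numerator_def by (rule degree_subsum_le) auto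

lemma degree_denominator:
  assumes "odd N"
  shows "degree denominator = exponent N"
proof (rule antisym)
  show "degree denominator \<le> exponent N"
    unfolding denominator_def by (rule degree_subsum_le) auto
  have "exponent i = exponent N \<longleftrightarrow> i = N" if "i \<le> N" for i
    using exponent_strict_mono[of i N] that by (cases "i = N") auto
  then have "coeff denominator (exponent N) = (\<Sum>i\<in>{i. i \<le> N \<and> odd i}. if i = N then complex_of_real (coefficient i) else 0)"
    unfolding denominator_def subsum_def coeff_sum coeff_monom by (intro sum.cong) auto
  also have "\<dots> = complex_of_real (coefficient N)"
    using assms by simp
  finally show "exponent N \<le> degree denominator"
    using coefficient_pos[of N] by (intro le_degree) simp
qed

end

section \<open>Exponent gaps and radii of a prescribed total degree\<close>

text \<open>
  Bernoulli's inequality: \<open>(1 + 1/h)^M \<ge> 1 + M/h \<ge> 4\<close>.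
\<close>

lemma ratio_power_le_quarter:
  fixes h M :: nat
  assumes "0 < h" "3 * h \<le> M"
  shows "(real h / (real h + 1)) ^ M \<le> 1 / 4"
proof -
  have "4 \<le> 1 + real M * (1 / real h)"
    using assms by (simp add: field_simps flip: of_nat_mult)
  also have "\<dots> \<le> (1 + 1 / real h) ^ M"
    by (rule Bernoulli_inequality) (simp add: order_trans[of _ 0])
  finally have "inverse ((1 + 1 / real h) ^ M) \<le> inverse 4"
    by (intro le_imp_inverse_le) auto
  moreover have "inverse ((1 + 1 / real h) ^ M) = (real h / (real h + 1)) ^ M"
    using assms by (subst power_inverse[symmetric]) (simp add: field_simps)
  ultimately show ?thesis by simp
qed

text \<open>
  There are \<open>2 J + 1\<close> radii, symmetric under inversion, and those in the unit disc are equally spaced with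
  step \<open>1 / (J + 1)\<close>. The gaps there grow in proportion to the radius, as they should for \<open>d\<close> uniformly distributed
  points. The central gap, at radius 1, is chosen last: it absorbs the difference between \<open>d\<close> and the sum
  \<open>8 J\<^sup>2\<close> of the other gaps, so that the total degree is exactly \<open>d\<close>.
\<close>

context
  fixes J d :: nat
begin

definition radius :: "nat \<Rightarrow> real" where
  "radius l = (if l \<le> J then (real l + 1) / (real J + 1) else (real J + 1) / (real (2 * J - l) + 1))"

definition gap :: "nat \<Rightarrow> nat" where
  "gap l = (if l = J then d - 8 * J\<^sup>2 else if l < J then 8 * l + 4 else 8 * (2 * J - l) + 4)"

lemma sum_gap:
  assumes "8 * J\<^sup>2 \<le> d"
  shows "(\<Sum>l<2 * J + 1. gap l) = d"
proof -
  have below: "i \<le> J \<Longrightarrow> (\<Sum>l<i. gap l) = 4 * i\<^sup>2" for i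
    by (induction i) (simp_all add: gap_def power2_eq_square)
  have above: "i \<le> J \<Longrightarrow> (\<Sum>l<J + 1 + i. gap l) + 4 * (J - i)\<^sup>2 = d" for i
  proof (induction i)
    case 0
    then show ?case using below[of J] assms by (simp add: gap_def)
  next
    case (Suc i)
    then obtain t where J: "J = Suc (i + t)" using less_imp_Suc_add by (auto simp: Suc_le_eq)
    then have "(J - i)\<^sup>2 = (J - Suc i)\<^sup>2 + 2 * (J - Suc i) + 1"
      by (simp add: power2_eq_square)
    moreover have "2 * J - (J + 1 + i) = J - Suc i" by simp
    then have "gap (J + 1 + i) = 8 * (J - Suc i) + 4"
      by (simp add: gap_def)
    ultimately show ?case using Suc by simp
  qed
  show ?thesis using above[of J] by (simp add: mult_2)
qed

lemma radius_ratio_below: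
  "l < J \<Longrightarrow> radius l / radius (Suc l) = real (Suc l) / (real (Suc l) + 1)"
  by (simp add: radius_def)

lemma radius_ratio_above:
  assumes "J \<le> l" "l < 2 * J"
  shows "radius l / radius (Suc l) = real (2 * J - l) / (real (2 * J - l) + 1)"
proof -
  have "radius l = (real J + 1) / (real (2 * J - l) + 1)"
    using assms by (cases "l = J") (simp_all add: radius_def)
  moreover have "radius (Suc l) = (real J + 1) / real (2 * J - l)"
    using assms by (simp add: radius_def of_nat_diff)
  ultimately show ?thesis
    using assms by simp
qed

lemma gap_ge:
  assumes "8 * J * (J + 1) \<le> d"
  shows "l < J \<Longrightarrow> 3 * Suc l \<le> gap l" "l < J \<Longrightarrow> 3 * Suc l \<le> gap (Suc l)"
    "J \<le> l \<Longrightarrow> 3 * (2 * J - l) \<le> gap l" "J \<le> l \<Longrightarrow> l < 2 * J \<Longrightarrow> 3 * (2 * J - l) \<le> gap (Suc l)"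
proof -
  have "8 * J \<le> d - 8 * J\<^sup>2"
    using assms by (simp add: power2_eq_square algebra_simps)
  then show "l < J \<Longrightarrow> 3 * Suc l \<le> gap l" "l < J \<Longrightarrow> 3 * Suc l \<le> gap (Suc l)"
    "J \<le> l \<Longrightarrow> 3 * (2 * J - l) \<le> gap l" "J \<le> l \<Longrightarrow> l < 2 * J \<Longrightarrow> 3 * (2 * J - l) \<le> gap (Suc l)"
    by (auto simp: gap_def)
qed

text \<open>
  The central gap is at most \<open>24 (J + 1)\<close> by the choice of \<open>J\<close>, and at radius 1 it is multiplied by 2. Any
  other gap is at most \<open>8 (J + 1)\<close> times the smaller one of its radius and the inverse of that radius.
\<close>

lemma gap_mesh:
  assumes "d < 8 * (J + 1) * (J + 2)" "l < 2 * J + 1"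
  shows "real (gap l) * (radius l + 1 / radius l) \<le> 48 * (real J + 1)"
proof -
  have unit_ratio: "(8 * x + 4) * ((x + 1) / (y + 1) + (y + 1) / (x + 1)) \<le> 48 * (y + 1)"
    if "0 \<le> x" "x \<le> y" for x y :: real
  proof -
    have "(x + 1) / (y + 1) \<le> (y + 1) / (x + 1)"
      using that by (intro frac_le) auto
    then have "(x + 1) / (y + 1) + (y + 1) / (x + 1) \<le> 2 * ((y + 1) / (x + 1))"
      by linarith
    then have "(8 * x + 4) * ((x + 1) / (y + 1) + (y + 1) / (x + 1))
        \<le> (8 * (x + 1)) * (2 * ((y + 1) / (x + 1)))"
      using that by (rule_tac mult_mono) (simp_all del: mult_le_cancel_left)
    also have "\<dots> = 16 * (y + 1)" using that by (simp add: field_simps)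
    finally show ?thesis using that by simp
  qed
  consider "l < J" | "l = J" | "J < l" by linarith
  then show ?thesis
  proof cases
    case 1
    then show ?thesis using unit_ratio[of l J] by (simp add: gap_def radius_def)
  next
    case 2
    have "d - 8 * J\<^sup>2 \<le> 24 * (J + 1)"
      using assms(1) by (simp add: power2_eq_square algebra_simps)
    then have "real (d - 8 * J\<^sup>2) \<le> real (24 * (J + 1))" by (rule of_nat_mono)
    then show ?thesis using 2 by (simp add: gap_def radius_def)
  next
    case 3
    then show ?thesis using unit_ratio[of "2 * J - l" J] by (simp add: gap_def radius_def add.commute)
  qed
qed

end

text \<open>
  The largest \<open>J\<close> with \<open>8 J (J + 1) \<le> d\<close> makes the central gap \<open>d - 8 J\<^sup>2\<close> at least \<open>8 J\<close> and at most
  \<open>24 (J + 1)\<close>. For \<open>d < 16\<close> it is \<open>J = 0\<close>, where the construction degenerates to \<open>1 / z^d\<close>.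
\<close>

lemma exists_half_length:
  assumes "0 < d"
  obtains J :: nat where "8 * J * (J + 1) \<le> d" "d < 8 * (J + 1) * (J + 2)" "(J + 1)\<^sup>2 \<le> d"
proof -
  define J where "J = (LEAST n. d < 8 * (n + 1) * (n + 2))"
  have "d < 8 * (d + 1) * (d + 2)" by simp
  then have upper: "d < 8 * (J + 1) * (J + 2)"
    unfolding J_def by (rule LeastI)
  have lower: "8 * J * (J + 1) \<le> d"
  proof (cases J)
    case (Suc n)
    then have "\<not> d < 8 * (n + 1) * (n + 2)"
      unfolding J_def by (intro not_less_Least) simp
    then show ?thesis using Suc by simp
  qed simp
  have "(J + 1)\<^sup>2 \<le> d"
  proof (cases "J = 0")
    case False
    then have "(J + 1) * (J + 1) \<le> 8 * J * (J + 1)" by (intro mult_right_mono) auto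
    then show ?thesis using lower by (simp add: power2_eq_square)
  qed (use assms in simp)
  with lower upper show ?thesis by (rule that)
qed

section \<open>Rational functions with spherical derivative of order \<open>\<surd>d\<close>\<close>

lemma spaced_monomials_radius_gap:
  assumes "0 < d" "8 * J * (J + 1) \<le> d" "d < 8 * (J + 1) * (J + 2)"
  shows "spaced_monomials (radius J) (gap J d) (2 * J + 1) (48 * (real J + 1))"
proof
  fix l
  show "0 < radius J l" if "l < 2 * J + 1"
    by (simp add: radius_def add_pos_nonneg)
  show "0 < gap J d l" if "l < 2 * J + 1"
  proof -
    have "0 < d - 8 * J\<^sup>2"
      using assms(1,2) by (cases "J = 0") (auto simp: power2_eq_square)
    then show ?thesis by (simp add: gap_def)
  qed
  show "real (gap J d l) * (radius J l + 1 / radius J l) \<le> 48 * (real J + 1)" if "l < 2 * J + 1"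
    using gap_mesh[OF assms(3) that] .
  have ratio: "(radius J l / radius J (Suc l)) ^ M \<le> 1 / 4"
    if l: "Suc l < 2 * J + 1" and M: "l < J \<Longrightarrow> 3 * Suc l \<le> M" "J \<le> l \<Longrightarrow> 3 * (2 * J - l) \<le> M" for M
  proof (cases "l < J")
    case True
    then show ?thesis
      using ratio_power_le_quarter[of "Suc l" M] M(1) by (simp only: radius_ratio_below)
  next
    case False
    then have l': "J \<le> l" "l < 2 * J" using l by simp_all
    show ?thesis
      unfolding radius_ratio_above[OF l'] using l' M(2) by (intro ratio_power_le_quarter) auto
  qed
  show "(radius J l / radius J (Suc l)) ^ gap J d l \<le> 1 / 4" if "Suc l < 2 * J + 1"
    using that gap_ge[OF assms(2), of l] by (intro ratio) auto
  show "(radius J l / radius J (Suc l)) ^ gap J d (Suc l) \<le> 1 / 4" if "Suc l < 2 * J + 1"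
    using that gap_ge[OF assms(2), of l] by (intro ratio) auto
qed simp

theorem theorem1:
  "\<exists>C::real. C > 0 \<and>
     (\<forall>d::nat. d \<ge> 2 \<longrightarrow>
        (\<exists>f. rational_function f \<and> has_degree f d \<and> K f \<le> C * sqrt (real d)))"
proof (intro exI[of _ "3072 * 48"] conjI allI impI)
  fix d :: nat assume "2 \<le> d"
  then have "0 < d" by simp
  obtain J where J: "8 * J * (J + 1) \<le> d" "d < 8 * (J + 1) * (J + 2)" "(J + 1)\<^sup>2 \<le> d"
    using exists_half_length[OF \<open>0 < d\<close>] .
  interpret L: spaced_monomials "radius J" "gap J d" "2 * J + 1" "48 * (real J + 1)"
    by (rule spaced_monomials_radius_gap) fact+
  have "8 * J\<^sup>2 \<le> d"
    using J(1) by (simp add: power2_eq_square)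
  then have d: "L.exponent (2 * J + 1) = d"
    unfolding L.exponent_def by (rule sum_gap)
  then have deg: "max (degree L.numerator) (degree L.denominator) = d"
    using L.degree_denominator L.degree_numerator_le by simp
  have "real J + 1 \<le> sqrt (real d)"
  proof (rule real_le_rsqrt)
    have "real ((J + 1)\<^sup>2) \<le> real d" using J(3) by (rule of_nat_mono)
    then show "(real J + 1)\<^sup>2 \<le> real d" by (simp add: add.commute)
  qed
  then have root: "3072 * (48 * (real J + 1)) \<le> 3072 * 48 * sqrt (real d)"
    by simp
  have "L.denominator \<noteq> 0"
    using L.degree_denominator d \<open>0 < d\<close> by auto
  then have "K (quotient_map_of L.numerator L.denominator) \<le> 3072 * (48 * (real J + 1))"
    using L.spherical_speed_le deg \<open>0 < d\<close>
    by (intro K_quotient_map_of_le L.coprime_numerator_denominator) auto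
  also note root
  finally have "K (quotient_map_of L.numerator L.denominator) \<le> 3072 * 48 * sqrt (real d)" .
  moreover have "rational_function (quotient_map_of L.numerator L.denominator)"
    by (rule rational_function_quotient_map_of[OF L.coprime_numerator_denominator])
  moreover have "has_degree (quotient_map_of L.numerator L.denominator) d"
    unfolding has_degree_def
    by (intro exI conjI, rule L.coprime_numerator_denominator, rule refl, rule deg[symmetric])
  ultimately show "\<exists>f. rational_function f \<and> has_degree f d \<and> K f \<le> 3072 * 48 * sqrt (real d)"
    by blast
qed simp

end
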